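(* If $G$ is a Barycentric (that is, Barycentric refined) finite abstract simplicial complex, then $\gamma(G)$, $\gamma(\phi(G))$ and $\gamma(\psi(G))$ are all homotopic topological spaces (i.e. homotopy equivalent to one another).
   Context: A finite abstract simplicial complex $G$ is a finite set of finite non-empty sets closed under taking non-empty subsets. $\psi(G)$ is the finite simple graph with vertex set $G$ in which distinct $a,b$ are adjacent iff $a\cap b\neq\emptyset$; $\phi(G)$ is the finite simple graph with vertex set $G$ in which distinct $a,b$ are adjacent iff $a\subset b$ or $b\subset a$. The Whitney (clique) complex of a graph is the complex of all non-empty vertex sets of complete subgraphs. A complex $G$ is called Barycentric (Barycentric refined) if it is the Whitney complex of $\phi(H)$ for some finite abstract simplicial complex $H$. For a complex $G$, $\gamma(G)$ is its geometric realization; for a graph $A$, $\gamma(A)$ is the geometric realization of its Whitney complex. *)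

theory Defs
  imports "HOL-Analysis.Analysis" "Graph_Theory.Kuratowski"
begin

definition finite_abstract_simplicial_complex :: "'a set set \<Rightarrow> bool" where
  "finite_abstract_simplicial_complex G \<longleftrightarrow>
     finite G \<and> (\<forall>a\<in>G. finite a \<and> a \<noteq> {} \<and> (\<forall>b. b \<subseteq> a \<and> b \<noteq> {} \<longrightarrow> b \<in> G))"

text \<open>
  A finite simple graph is a \<^const>\<open>pair_graph\<close>: a finite loop-free digraph whose
  adjacency relation is symmetric.
\<close>

definition psi :: "'a set set \<Rightarrow> 'a set pair_pre_digraph" where
  "psi G = \<lparr> pverts = G, parcs = {(a, b). a \<in> G \<and> b \<in> G \<and> a \<noteq> b \<and> a \<inter> b \<noteq> {}} \<rparr>"

definition phi :: "'a set set \<Rightarrow> 'a set pair_pre_digraph" where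
  "phi G = \<lparr> pverts = G, parcs = {(a, b). a \<in> G \<and> b \<in> G \<and> (a \<subset> b \<or> b \<subset> a)} \<rparr>"

lemma pair_graph_psi:
  assumes "finite G"
  shows "pair_graph (psi G)"
proof
  have "parcs (psi G) \<subseteq> G \<times> G"
    by (auto simp: psi_def)
  with assms show "finite (parcs (psi G))"
    by (meson finite_SigmaI finite_subset)
qed (use assms in \<open>auto simp: psi_def symmetric_def sym_def\<close>)

lemma pair_graph_phi:
  assumes "finite G"
  shows "pair_graph (phi G)"
proof
  have "parcs (phi G) \<subseteq> G \<times> G"
    by (auto simp: phi_def)
  with assms show "finite (parcs (phi G))"
    by (meson finite_SigmaI finite_subset)
qed (use assms in \<open>auto simp: phi_def symmetric_def sym_def\<close>)

definition whitney_complex :: "'a pair_pre_digraph \<Rightarrow> 'a set set" where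
  "whitney_complex A =
     {pverts K |K n. subgraph (with_proj K) (with_proj A) \<and> complete_digraph n (with_proj K)
        \<and> pverts K \<noteq> {}}"

lemma whitney_complex_iff:
  assumes "pair_graph A"
  shows "\<sigma> \<in> whitney_complex A \<longleftrightarrow>
           \<sigma> \<noteq> {} \<and> \<sigma> \<subseteq> pverts A \<and> pairwise (\<lambda>u v. (u, v) \<in> parcs A) \<sigma>"
proof
  assume "\<sigma> \<in> whitney_complex A"
  then show "\<sigma> \<noteq> {} \<and> \<sigma> \<subseteq> pverts A \<and> pairwise (\<lambda>u v. (u, v) \<in> parcs A) \<sigma>"
    by (auto simp: whitney_complex_def subgraph_def complete_digraph_pair_def pairwise_def)
next
  interpret pair_graph A by fact
  assume *: "\<sigma> \<noteq> {} \<and> \<sigma> \<subseteq> pverts A \<and> pairwise (\<lambda>u v. (u, v) \<in> parcs A) \<sigma>"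
  define K where "K = \<lparr> pverts = \<sigma>, parcs = {(u, v). (u, v) \<in> \<sigma> \<times> \<sigma> \<and> u \<noteq> v} \<rparr>"
  have fin: "finite \<sigma>"
    using * pair_finite_verts finite_subset by blast
  have "complete_digraph (card \<sigma>) (with_proj K)"
    using fin by (simp add: complete_digraph_pair_def K_def)
  moreover have "subgraph (with_proj K) (with_proj A)"
    unfolding subgraph_def
  proof (intro conjI)
    show "wf_digraph (with_proj A)"
      by (rule wf_digraph)
    show "wf_digraph (with_proj K)"
      by (auto simp: wf_digraph_def K_def)
  qed (use * in \<open>auto simp: K_def compatible_def pairwise_def\<close>)
  moreover have "pverts K = \<sigma>"
    by (simp add: K_def)
  ultimately show "\<sigma> \<in> whitney_complex A"
    using * unfolding whitney_complex_def by blast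
qed

lemma finite_abstract_simplicial_complex_whitney_complex:
  assumes "pair_graph A"
  shows "finite_abstract_simplicial_complex (whitney_complex A)"
proof -
  interpret pair_graph A by fact
  have "whitney_complex A \<subseteq> Pow (pverts A)"
    using whitney_complex_iff[OF assms] by auto
  then have "finite (whitney_complex A)"
    by (rule finite_subset) (simp add: pair_finite_verts)
  moreover have "finite a" if "a \<in> whitney_complex A" for a
    using that pair_finite_verts finite_subset unfolding whitney_complex_iff[OF assms] by blast
  moreover have "b \<in> whitney_complex A"
    if "a \<in> whitney_complex A" "b \<subseteq> a" "b \<noteq> {}" for a b
    using that unfolding whitney_complex_iff[OF assms] by (meson order_trans pairwise_subset)
  ultimately show ?thesis
    unfolding finite_abstract_simplicial_complex_def
    using whitney_complex_iff[OF assms] by blast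
qed

definition barycentric :: "'a set set set \<Rightarrow> bool" where
  "barycentric G \<longleftrightarrow>
     (\<exists>H :: 'a set set. finite_abstract_simplicial_complex H \<and> G = whitney_complex (phi H))"

lemma barycentric_imp_finite_abstract_simplicial_complex:
  assumes "barycentric G"
  shows "finite_abstract_simplicial_complex G"
proof -
  obtain H where "finite_abstract_simplicial_complex H" and G: "G = whitney_complex (phi H)"
    using assms unfolding barycentric_def by blast
  then have "finite H"
    by (simp add: finite_abstract_simplicial_complex_def)
  then show ?thesis
    unfolding G by (intro finite_abstract_simplicial_complex_whitney_complex pair_graph_phi)
qed

text \<open>
  Points are given by barycentric coordinates, extended by 0 outside the vertices of \<open>G\<close>.
  The product topology is the usual topology of the realization only because \<open>G\<close> is
  finite; for infinite complexes it is coarser than the weak topology.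
\<close>

definition geometric_realization :: "'a set set \<Rightarrow> ('a \<Rightarrow> real) topology" where
  "geometric_realization G =
     subtopology (powertop_real UNIV)
       {x. (\<forall>v. 0 \<le> x v) \<and> {v. x v \<noteq> 0} \<in> G \<and> (\<Sum>v | x v \<noteq> 0. x v) = 1}"

definition graph_realization :: "'a pair_pre_digraph \<Rightarrow> ('a \<Rightarrow> real) topology" where
  "graph_realization A = geometric_realization (whitney_complex A)"

end

theory Submission
  imports Defs
begin

text \<open>
  Everything follows from one explicit version of Quillen's fiber theorem,
  \<open>homotopy_equivalent_order_complex\<close>. Let \<open>K\<close> be a finite complex, \<open>P\<close> a finite family of sets
  ordered by inclusion, and \<open>F \<mapsto> \<Union>(j ` F)\<close> a monotone map from the faces of \<open>K\<close> to \<open>P\<close>. If for every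
  \<open>p \<in> P\<close> the subcomplex spanned by \<open>{a. j a \<subseteq> p}\<close> can be reduced to a cone by deleting dominated
  vertices, then \<open>K\<close> is homotopy equivalent to the complex of chains in \<open>P\<close>.

  Both complexes sit in a mapping cylinder, whose simplices consist of a face \<open>F\<close> of \<open>K\<close> and a chain
  in \<open>P\<close> lying above \<open>\<Union>(j ` F)\<close>. The cylinder deforms onto the chains by lowering all coordinates on
  \<open>F\<close> at unit speed: what is lost while exactly the vertices in \<open>F'\<close> have a positive coordinate goes
  to the element \<open>\<Union>(j ` F')\<close>, up to normalisation; since \<open>F'\<close> shrinks, the elements that receive
  mass form a chain. The cylinder deforms
  onto \<open>K\<close> by deleting the elements of \<open>P\<close>, minimal ones first: each deletion is a sequence of
  elementary collapses that follows the dismantling of the fiber.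

  For \<open>j v = {v}\<close> and \<open>P = K\<close> the fibers are simplices, and the theorem says that the barycentric
  subdivision of \<open>K\<close> is equivalent to \<open>K\<close>. This handles \<open>phi\<close>.

  For \<open>psi\<close>, let \<open>G\<close> be the complex of chains in the simplicial complex \<open>H\<close>. A clique of \<open>psi G\<close> is a
  family of pairwise intersecting chains, so the minimum \<open>\<Inter>A\<close> of each chain lies below the maximum of
  every other chain. Hence the union of all the minima is a non-empty face of a simplex of \<open>H\<close>, that
  is, an element of \<open>H\<close>; here it matters that \<open>H\<close> is a simplicial complex and not just any poset.
  Thus \<open>j = Inter\<close> is admissible with \<open>P = H\<close>. The fiber over \<open>h\<close> consists of the chains whose minimum
  is contained in \<open>h\<close>. It is dismantled by replacing the members \<open>x\<close> of the chains by \<open>x \<inter> h\<close>, one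
  cardinality of \<open>x\<close> at a time, until all chains lie below \<open>h\<close> and can be extended by \<open>h\<close>
  (\<open>dismantlable_chains_below\<close>).
\<close>

section \<open>Maps into geometric realizations\<close>

abbreviation supp :: "('a \<Rightarrow> real) \<Rightarrow> 'a set" where
  "supp x \<equiv> {v. x v \<noteq> 0}"

lemma complex_finite_vertices:
  "finite_abstract_simplicial_complex K \<Longrightarrow> finite (\<Union>K)"
  by (auto simp: finite_abstract_simplicial_complex_def)

lemma complex_face:
  "\<lbrakk>finite_abstract_simplicial_complex K; \<sigma> \<in> K; \<tau> \<subseteq> \<sigma>; \<tau> \<noteq> {}\<rbrakk> \<Longrightarrow> \<tau> \<in> K"
  unfolding finite_abstract_simplicial_complex_def by blast

lemma complex_face_or_empty:
  "\<lbrakk>finite_abstract_simplicial_complex K; \<sigma> \<in> insert {} K; \<tau> \<subseteq> \<sigma>\<rbrakk> \<Longrightarrow> \<tau> \<in> insert {} K"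
  by (cases "\<tau> = {}") (auto intro: complex_face)

lemma complex_nonempty:
  "\<lbrakk>finite_abstract_simplicial_complex K; \<sigma> \<in> K\<rbrakk> \<Longrightarrow> \<sigma> \<noteq> {}"
  unfolding finite_abstract_simplicial_complex_def by blast

text \<open>
  Replacing the sum over the support by a sum over a fixed finite set of vertices makes the
  condition on the total mass accessible to linearity and continuity arguments.
\<close>
lemma topspace_geometric_realization:
  assumes "finite V" "\<Union>K \<subseteq> V"
  shows "x \<in> topspace (geometric_realization K) \<longleftrightarrow>
           (\<forall>v. 0 \<le> x v) \<and> supp x \<in> K \<and> sum x V = 1"
proof -
  have "sum x (supp x) = sum x V" if "supp x \<in> K"
    using assms that by (intro sum.mono_neutral_left) auto
  then show ?thesis
    by (auto simp: geometric_realization_def)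
qed

lemma continuous_map_coordinate:
  "continuous_map (geometric_realization K) euclideanreal (\<lambda>x. x v)"
  unfolding geometric_realization_def
  by (intro continuous_map_from_subtopology continuous_map_product_projection) auto

lemma continuous_map_into_geometric_realization:
  assumes "finite V" "\<Union>K \<subseteq> V"
    and "\<And>v. continuous_map X euclideanreal (\<lambda>t. f t v)"
    and "\<And>t v. t \<in> topspace X \<Longrightarrow> 0 \<le> f t v"
    and "\<And>t. t \<in> topspace X \<Longrightarrow> supp (f t) \<in> K"
    and "\<And>t. t \<in> topspace X \<Longrightarrow> sum (f t) V = 1"
  shows "continuous_map X (geometric_realization K) f"
proof -
  have "f t \<in> topspace (geometric_realization K)" if "t \<in> topspace X" for t
    using assms that by (simp add: topspace_geometric_realization[OF assms(1,2)])
  then have "f \<in> topspace X \<rightarrow> topspace (geometric_realization K)"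
    by blast
  then show ?thesis
    using assms(3)
    by (auto simp: geometric_realization_def continuous_map_in_subtopology
        continuous_map_componentwise_UNIV)
qed

text \<open>
  If \<open>f x\<close> and \<open>g x\<close> always lie in a common closed simplex, the segment between them stays in that
  simplex, so the straight-line homotopy is defined.
\<close>
lemma homotopic_contiguous_maps:
  assumes L: "finite_abstract_simplicial_complex L"
    and f: "continuous_map X (geometric_realization L) f"
    and g: "continuous_map X (geometric_realization L) g"
    and contiguous: "\<And>x. x \<in> topspace X \<Longrightarrow> \<exists>\<sigma>\<in>L. supp (f x) \<union> supp (g x) \<subseteq> \<sigma>"
  shows "homotopic_with (\<lambda>_. True) X (geometric_realization L) f g"
proof -
  note V = complex_finite_vertices[OF L] order_refl
  define h where "h = (\<lambda>(t, x) v. (1 - t) * f x v + t * g x v)"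
  have *: "\<forall>v. 0 \<le> f x v" "supp (f x) \<in> L" "sum (f x) (\<Union>L) = 1"
          "\<forall>v. 0 \<le> g x v" "supp (g x) \<in> L" "sum (g x) (\<Union>L) = 1" if "x \<in> topspace X" for x
    using that continuous_map_funspace[OF f] continuous_map_funspace[OF g]
    unfolding Pi_iff topspace_geometric_realization[OF V] by blast+
  have "continuous_map (prod_topology (top_of_set {0..1}) X) (geometric_realization L) h"
  proof (rule continuous_map_into_geometric_realization[OF V])
    fix v
    have "continuous_map X euclideanreal (\<lambda>x. f x v)" "continuous_map X euclideanreal (\<lambda>x. g x v)"
      using continuous_map_compose[OF f continuous_map_coordinate[of L v]]
        continuous_map_compose[OF g continuous_map_coordinate[of L v]] by (simp_all add: o_def)
    then have c: "continuous_map (prod_topology (top_of_set {0..1}) X) euclideanreal (\<lambda>p. f (snd p) v)"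
      "continuous_map (prod_topology (top_of_set {0..1}) X) euclideanreal (\<lambda>p. g (snd p) v)"
      by (auto dest: continuous_map_compose[OF continuous_map_snd] simp: o_def)
    have "continuous_map (prod_topology (top_of_set {0..1::real}) X) euclideanreal fst"
      by (meson continuous_map_fst continuous_map_into_fulltopology)
    with c show "continuous_map (prod_topology (top_of_set {0..1}) X) euclideanreal (\<lambda>p. h p v)"
      unfolding h_def case_prod_beta by (intro continuous_intros) auto
  next
    fix p :: "real \<times> 'b" and v
    assume "p \<in> topspace (prod_topology (top_of_set {0..1}) X)"
    then show "0 \<le> h p v"
      using * by (auto simp: h_def)
  next
    fix p :: "real \<times> 'b"
    assume p: "p \<in> topspace (prod_topology (top_of_set {0..1}) X)"
    obtain t x where tx: "p = (t, x)" "0 \<le> t" "t \<le> 1" "x \<in> topspace X"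
      using p by auto
    have "sum (h p) (\<Union>L) = (1 - t) * sum (f x) (\<Union>L) + t * sum (g x) (\<Union>L)"
      by (simp add: h_def tx sum.distrib sum_distrib_left)
    then show sum1: "sum (h p) (\<Union>L) = 1"
      using * tx by simp
    then have "supp (h p) \<noteq> {}"
      by (metis (mono_tags, lifting) empty_Collect_eq sum.neutral zero_neq_one)
    moreover have "supp (h p) \<subseteq> supp (f x) \<union> supp (g x)"
      by (auto simp: h_def tx)
    ultimately show "supp (h p) \<in> L"
      using contiguous[OF tx(4)] complex_face[OF L] by (meson order_trans)
  qed
  then show ?thesis
    unfolding homotopic_with_def by (intro exI[of _ h]) (simp add: h_def)
qed

lemma homotopy_equivalent_isomorphic_complex:
  fixes i :: "'a \<Rightarrow> 'b"
  assumes K: "finite_abstract_simplicial_complex K" and i: "inj i"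
  shows "geometric_realization ((`) i ` K) homotopy_equivalent_space geometric_realization K"
proof (rule homeomorphic_imp_homotopy_equivalent_space)
  note V = complex_finite_vertices[OF K] order_refl
  have V': "finite (i ` \<Union>K)" "\<Union>((`) i ` K) \<subseteq> i ` \<Union>K"
    using V by auto
  define r where "r x v = (x (i v) :: real)" for x v
  define s where "s y w = (if w \<in> range i then y (inv i w) else 0 :: real)" for y w
  have rs: "r (s y) = y" for y
    by (simp add: r_def s_def i fun_eq_iff)
  have supp_s: "supp (s y) = i ` supp y" for y
    using i by (auto simp: s_def image_iff dest: injD)
  have "continuous_map (geometric_realization K) (geometric_realization ((`) i ` K)) s"
  proof (rule continuous_map_into_geometric_realization[OF V'])
    show "continuous_map (geometric_realization K) euclideanreal (\<lambda>y. s y w)" for w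
      by (cases "w \<in> range i") (auto simp: s_def continuous_map_coordinate)
    fix y
    assume "y \<in> topspace (geometric_realization K)"
    then have y: "\<forall>v. 0 \<le> y v" "supp y \<in> K" "sum y (\<Union>K) = 1"
      using topspace_geometric_realization[OF V] by auto
    show "0 \<le> s y w" for w
      using y(1) by (simp add: s_def)
    show "supp (s y) \<in> (`) i ` K"
      using y(2) unfolding supp_s by (rule imageI)
    show "sum (s y) (i ` \<Union>K) = 1"
      using y(3) by (simp add: sum.reindex inj_on_subset[OF i] s_def i)
  qed
  moreover have *: "supp x = i ` supp (r x)" "\<forall>v. 0 \<le> r x v" "supp (r x) \<in> K" "sum (r x) (\<Union>K) = 1"
      if x: "x \<in> topspace (geometric_realization ((`) i ` K))" for x
  proof -
    have x: "\<forall>w. 0 \<le> x w" "supp x \<in> (`) i ` K" "sum x (i ` \<Union>K) = 1"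
      using x topspace_geometric_realization[OF V'] by auto
    then obtain \<sigma> where \<sigma>: "\<sigma> \<in> K" "supp x = i ` \<sigma>"
      by auto
    have "supp (r x) = \<sigma>"
    proof -
      have "x (i v) \<noteq> 0 \<longleftrightarrow> v \<in> \<sigma>" for v
        using \<sigma>(2) i by (metis (mono_tags, lifting) inj_image_mem_iff mem_Collect_eq)
      then show ?thesis by (simp add: r_def)
    qed
    then show "supp x = i ` supp (r x)" "supp (r x) \<in> K"
      using \<sigma> by auto
    show "\<forall>v. 0 \<le> r x v" "sum (r x) (\<Union>K) = 1"
      using x by (auto simp: r_def sum.reindex inj_on_subset[OF i])
  qed
  moreover have "continuous_map (geometric_realization ((`) i ` K)) (geometric_realization K) r"
  proof (rule continuous_map_into_geometric_realization[OF V])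
    show "continuous_map (geometric_realization ((`) i ` K)) euclideanreal (\<lambda>x. r x v)" for v
      unfolding r_def by (rule continuous_map_coordinate)
  qed (use * in auto)
  moreover have "s (r x) = x" if "x \<in> topspace (geometric_realization ((`) i ` K))" for x
  proof
    fix w
    show "s (r x) w = x w"
      using *(1)[OF that] by (cases "w \<in> range i") (auto simp: s_def r_def i)
  qed
  ultimately show "geometric_realization ((`) i ` K) homeomorphic_space geometric_realization K"
    unfolding homeomorphic_space_def homeomorphic_maps_def
    by (intro exI[of _ r] exI[of _ s] conjI ballI) (simp_all add: rs)
qed

section \<open>Elementary collapses\<close>

lemma continuous_map_Min:
  fixes f :: "'i \<Rightarrow> 'a \<Rightarrow> real"
  assumes "finite A" "A \<noteq> {}" "\<And>a. a \<in> A \<Longrightarrow> continuous_map X euclideanreal (f a)"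
  shows "continuous_map X euclideanreal (\<lambda>x. Min ((\<lambda>a. f a x) ` A))"
  using assms
  by (induction rule: finite_ne_induct) (auto intro: continuous_map_real_min)

text \<open>
  The shape of complex that occurs halfway through the deletion of a vertex \<open>v\<close>, when some of the
  edges at \<open>v\<close> have already been removed.
\<close>
lemma complex_restrict_star:
  assumes "finite_abstract_simplicial_complex Z"
  shows "finite_abstract_simplicial_complex {\<sigma> \<in> Z. v \<in> \<sigma> \<longrightarrow> f -` \<sigma> \<subseteq> V}"
  unfolding finite_abstract_simplicial_complex_def
proof (intro conjI ballI allI impI)
  show "finite {\<sigma> \<in> Z. v \<in> \<sigma> \<longrightarrow> f -` \<sigma> \<subseteq> V}"
    using assms by (simp add: finite_abstract_simplicial_complex_def)
  fix \<sigma>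
  assume \<sigma>: "\<sigma> \<in> {\<sigma> \<in> Z. v \<in> \<sigma> \<longrightarrow> f -` \<sigma> \<subseteq> V}"
  then show "finite \<sigma>" "\<sigma> \<noteq> {}"
    using assms unfolding finite_abstract_simplicial_complex_def by auto
  fix \<tau>
  assume \<tau>: "\<tau> \<subseteq> \<sigma> \<and> \<tau> \<noteq> {}"
  then have "\<tau> \<in> Z"
    using complex_face[OF assms, of \<sigma> \<tau>] \<sigma> by simp
  moreover have "f -` \<tau> \<subseteq> f -` \<sigma>"
    using \<tau> by (intro vimage_mono) simp
  ultimately show "\<tau> \<in> {\<sigma> \<in> Z. v \<in> \<sigma> \<longrightarrow> f -` \<sigma> \<subseteq> V}"
    using \<sigma> \<tau> by auto
qed

text \<open>
  The open star of \<open>\<sigma>\<^sub>0\<close> can be pushed away from \<open>\<sigma>\<^sub>0\<close> because its link is a cone with apex \<open>u\<close>: lower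
  all coordinates on \<open>\<sigma>\<^sub>0\<close> by their minimum and give the mass so gained to \<open>u\<close>. Points outside the star
  do not move, since there the minimum is 0. The lemma is used for a vertex \<open>\<sigma>\<^sub>0\<close> dominated by \<open>u\<close> and
  for an edge \<open>\<sigma>\<^sub>0\<close>.
\<close>
lemma homotopy_equivalent_delete_star:
  assumes K: "finite_abstract_simplicial_complex K"
    and \<sigma>0: "finite \<sigma>\<^sub>0" "\<sigma>\<^sub>0 \<noteq> {}" "u \<notin> \<sigma>\<^sub>0"
    and cone: "\<And>\<sigma>. \<lbrakk>\<sigma> \<in> K; \<sigma>\<^sub>0 \<subseteq> \<sigma>\<rbrakk> \<Longrightarrow> insert u \<sigma> \<in> K"
  shows "geometric_realization K homotopy_equivalent_space
         geometric_realization {\<sigma> \<in> K. \<not> \<sigma>\<^sub>0 \<subseteq> \<sigma>}"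
proof -
  define K' where "K' = {\<sigma> \<in> K. \<not> \<sigma>\<^sub>0 \<subseteq> \<sigma>}"
  define V where "V = insert u (\<sigma>\<^sub>0 \<union> \<Union>K)"
  have V: "finite V" "\<Union>K \<subseteq> V" "\<Union>K' \<subseteq> V"
    using complex_finite_vertices[OF K] \<sigma>0 by (auto simp: V_def K'_def)
  define m where "m x = Min (x ` \<sigma>\<^sub>0)" for x :: "'a \<Rightarrow> real"
  define r where "r x v = x v - (if v \<in> \<sigma>\<^sub>0 then m x else 0)
                            + (if v = u then card \<sigma>\<^sub>0 * m x else 0)" for x v
  have m_le: "m x \<le> x v" if "v \<in> \<sigma>\<^sub>0" for x v
    using that \<sigma>0 by (simp add: m_def)
  have m_attained: "\<exists>v\<in>\<sigma>\<^sub>0. x v = m x" for x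
  proof -
    have "m x \<in> x ` \<sigma>\<^sub>0"
      unfolding m_def using \<sigma>0 by (intro Min_in) auto
    then show ?thesis by auto
  qed
  have r_ident: "r x = x" if "m x = 0" for x
    using that by (simp add: r_def fun_eq_iff)
  have sum_r: "sum (r x) V = sum x V" for x
  proof -
    have "(\<Sum>v\<in>V. if v \<in> \<sigma>\<^sub>0 then m x else 0) = card \<sigma>\<^sub>0 * m x"
      using V(1) by (simp add: sum.If_cases V_def Int_absorb1 subset_insertI2)
    moreover have "(\<Sum>v\<in>V. if v = u then card \<sigma>\<^sub>0 * m x else 0) = card \<sigma>\<^sub>0 * m x"
      using V(1) by (simp add: V_def)
    ultimately show ?thesis
      by (simp add: r_def sum.distrib sum_subtractf)
  qed
  have r: "0 \<le> r x v" "supp (r x) \<in> K'" "\<exists>\<sigma>\<in>K. supp (r x) \<union> supp x \<subseteq> \<sigma>"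
    if "x \<in> topspace (geometric_realization K)" for x v
  proof -
    have x: "\<forall>v. 0 \<le> x v" "supp x \<in> K" "sum x V = 1"
      using that topspace_geometric_realization[OF V(1,2)] by auto
    have m_nonneg: "0 \<le> m x"
      using m_attained[of x] x(1) by metis
    show "0 \<le> r x v"
      using m_le[of v x] x(1) m_nonneg by (simp add: r_def)
    have not_star: "\<not> \<sigma>\<^sub>0 \<subseteq> supp (r x)"
      using m_attained[of x] \<sigma>0(3) by (auto simp: r_def)
    consider "m x = 0" | "m x > 0"
      using m_nonneg by linarith
    then have "supp (r x) \<in> K' \<and> (\<exists>\<sigma>\<in>K. supp (r x) \<union> supp x \<subseteq> \<sigma>)"
    proof cases
      case 1
      then show ?thesis
        using x(2) not_star by (auto simp: r_ident K'_def)
    next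
      case 2
      then have "\<sigma>\<^sub>0 \<subseteq> supp x"
        using m_le[of _ x] by fastforce
      then have \<sigma>: "insert u (supp x) \<in> K"
        using cone x(2) by blast
      have sub: "supp (r x) \<subseteq> insert u (supp x)"
        using \<open>\<sigma>\<^sub>0 \<subseteq> supp x\<close> by (auto simp: r_def split: if_splits)
      have "supp (r x) \<noteq> {}"
        using sum_r[of x] x(3) by (metis (mono_tags, lifting) empty_Collect_eq sum.neutral zero_neq_one)
      then have "supp (r x) \<in> K"
        using complex_face[OF K \<sigma> sub] by blast
      then show ?thesis
        using \<sigma> sub not_star by (auto simp: K'_def)
    qed
    then show "supp (r x) \<in> K'" "\<exists>\<sigma>\<in>K. supp (r x) \<union> supp x \<subseteq> \<sigma>"
      by auto
  qed
  have cont_r: "continuous_map (geometric_realization K) (geometric_realization L) r"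
    if L: "K' \<subseteq> L" "\<Union>L \<subseteq> V" for L
  proof (rule continuous_map_into_geometric_realization[OF V(1) L(2)])
    have "continuous_map (geometric_realization K) euclideanreal m"
      unfolding m_def using \<sigma>0 by (intro continuous_map_Min continuous_map_coordinate) auto
    then show "continuous_map (geometric_realization K) euclideanreal (\<lambda>x. r x v)" for v
      unfolding r_def by (intro continuous_intros continuous_map_coordinate) auto
  qed (use r L sum_r topspace_geometric_realization[OF V(1,2)] in auto)
  have subK: "K' \<subseteq> K"
    by (auto simp: K'_def)
  have id_cont: "continuous_map (geometric_realization K') (geometric_realization K) id"
    using continuous_map_coordinate subK
    by (intro continuous_map_into_geometric_realization[OF V(1,2)])
       (auto simp: topspace_geometric_realization[OF V(1,3)])
  have "r x = x" if "x \<in> topspace (geometric_realization K')" for x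
  proof (rule r_ident)
    have x: "\<forall>v. 0 \<le> x v" "supp x \<in> K'"
      using that topspace_geometric_realization[OF V(1,3)] by auto
    then obtain v where "v \<in> \<sigma>\<^sub>0" "x v = 0"
      by (auto simp: K'_def)
    then show "m x = 0"
      using m_le[of v x] m_attained[of x] x(1) by (metis order_antisym)
  qed
  then have "retraction_maps (geometric_realization K) (geometric_realization K') r id"
    unfolding retraction_maps_def using cont_r[OF order_refl V(3)] id_cont by auto
  moreover have "homotopic_with (\<lambda>_. True) (geometric_realization K) (geometric_realization K) r id"
    using r(3) by (intro homotopic_contiguous_maps[OF K] cont_r subK V(2)) auto
  ultimately show ?thesis
    unfolding K'_def[symmetric]
    by (rule deformation_retract_imp_homotopy_equivalent_space[rotated])
qed


section \<open>The cylinder of a map from a complex to a poset\<close>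

lemma chain_subset_mono: "\<lbrakk>chain\<^sub>\<subseteq> A; B \<subseteq> A\<rbrakk> \<Longrightarrow> chain\<^sub>\<subseteq> B"
  unfolding chain_subset_def by (meson subsetD)

lemma whitney_complex_phi_iff:
  assumes "finite P"
  shows "\<sigma> \<in> whitney_complex (phi P) \<longleftrightarrow> \<sigma> \<noteq> {} \<and> \<sigma> \<subseteq> P \<and> chain\<^sub>\<subseteq> \<sigma>"
  unfolding whitney_complex_iff[OF pair_graph_phi[OF assms]]
  by (auto simp: phi_def chain_subset_def pairwise_def)

text \<open>
  A simplex of the mapping cylinder of \<open>F \<mapsto> \<Union>(j ` F)\<close>: a face of \<open>K\<close> and a chain in \<open>P\<close> above its
  image, either of which may be missing.
\<close>
definition cylinder :: "'a set set \<Rightarrow> 'b set set \<Rightarrow> ('a \<Rightarrow> 'b set) \<Rightarrow> ('a + 'b set) set set" where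
  "cylinder K P j =
     {\<sigma>. \<sigma> \<noteq> {} \<and> Inl -` \<sigma> \<in> insert {} K \<and> Inr -` \<sigma> \<subseteq> P \<and> chain\<^sub>\<subseteq> (Inr -` \<sigma>) \<and>
        (\<forall>a\<in>Inl -` \<sigma>. \<forall>p\<in>Inr -` \<sigma>. j a \<subseteq> p)}"

lemma cylinder_vertices: "\<Union>(cylinder K P j) \<subseteq> \<Union>K <+> P"
proof
  fix w
  assume "w \<in> \<Union>(cylinder K P j)"
  then obtain \<sigma> where "w \<in> \<sigma>" "Inl -` \<sigma> \<in> insert {} K" "Inr -` \<sigma> \<subseteq> P"
    by (auto simp: cylinder_def)
  then show "w \<in> \<Union>K <+> P"
    by (cases w) auto
qed

lemma complex_cylinder:
  assumes K: "finite_abstract_simplicial_complex K" and P: "finite P"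
  shows "finite_abstract_simplicial_complex (cylinder K P j)"
  unfolding finite_abstract_simplicial_complex_def
proof (intro conjI ballI allI impI)
  have fin: "finite (\<Union>K <+> P)"
    using complex_finite_vertices[OF K] P by simp
  have "cylinder K P j \<subseteq> Pow (\<Union>K <+> P)"
    using cylinder_vertices[of K P j] by blast
  then show "finite (cylinder K P j)"
    using fin finite_subset by blast
  fix \<sigma>
  assume \<sigma>: "\<sigma> \<in> cylinder K P j"
  show "finite \<sigma>"
    using \<sigma> cylinder_vertices[of K P j] fin by (meson Sup_upper finite_subset)
  show "\<sigma> \<noteq> {}"
    using \<sigma> by (simp add: cylinder_def)
  fix \<tau>
  assume \<tau>: "\<tau> \<subseteq> \<sigma> \<and> \<tau> \<noteq> {}"
  then have sub: "Inl -` \<tau> \<subseteq> Inl -` \<sigma>" "Inr -` \<tau> \<subseteq> Inr -` \<sigma>"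
    by auto
  have "Inl -` \<tau> \<in> insert {} K"
    by (rule complex_face_or_empty[OF K _ sub(1)]) (use \<sigma> in \<open>simp add: cylinder_def\<close>)
  moreover have "Inr -` \<tau> \<subseteq> P"
    using \<sigma> sub(2) by (auto simp: cylinder_def)
  moreover have "chain\<^sub>\<subseteq> (Inr -` \<tau>)"
  proof -
    have "chain\<^sub>\<subseteq> (Inr -` \<sigma>)"
      using \<sigma> by (simp add: cylinder_def)
    then show ?thesis
      using sub(2) by (rule chain_subset_mono)
  qed
  moreover have "\<forall>a\<in>Inl -` \<tau>. \<forall>p\<in>Inr -` \<tau>. j a \<subseteq> p"
  proof -
    have "\<forall>a\<in>Inl -` \<sigma>. \<forall>p\<in>Inr -` \<sigma>. j a \<subseteq> p"
      using \<sigma> by (simp add: cylinder_def)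
    then show ?thesis
      using sub by (meson subsetD)
  qed
  ultimately show "\<tau> \<in> cylinder K P j"
    using \<tau> by (simp add: cylinder_def)
qed

lemma cylinder_empty_base:
  fixes j :: "'a \<Rightarrow> 'b set"
  assumes "finite_abstract_simplicial_complex K"
  shows "cylinder K {} j = (`) Inl ` K"
proof (intro set_eqI iffI)
  fix \<sigma>
  assume \<sigma>: "\<sigma> \<in> cylinder K {} j"
  then have "Inr -` \<sigma> = {}"
    by (simp add: cylinder_def)
  then have eq: "\<sigma> = Inl ` (Inl -` \<sigma>)"
    by (auto simp: image_iff) (metis Inr_not_Inl sumE vimageI2 empty_iff)
  moreover have "\<sigma> \<noteq> {}" "Inl -` \<sigma> \<in> insert {} K"
    using \<sigma> by (simp_all add: cylinder_def)
  ultimately have "Inl -` \<sigma> \<in> K"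
    by (metis image_empty insertE)
  with eq show "\<sigma> \<in> (`) Inl ` K"
    by blast
next
  fix \<sigma> :: "('a + 'b set) set"
  assume "\<sigma> \<in> (`) Inl ` K"
  then obtain F where F: "F \<in> K" "\<sigma> = Inl ` F"
    by auto
  have "Inl -` \<sigma> = F" "Inr -` \<sigma> = {}"
    by (auto simp: F)
  then show "\<sigma> \<in> cylinder K {} j"
    using F complex_nonempty[OF assms F(1)] by (simp add: cylinder_def chain_subset_def)
qed

lemma cylinder_top:
  fixes j :: "'a \<Rightarrow> 'b set"
  assumes "finite P"
  shows "{\<sigma> \<in> cylinder K P j. Inl -` \<sigma> = {}} = (`) Inr ` whitney_complex (phi P)"
proof (intro set_eqI iffI)
  fix \<sigma>
  assume "\<sigma> \<in> {\<sigma> \<in> cylinder K P j. Inl -` \<sigma> = {}}"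
  then have \<sigma>: "\<sigma> \<in> cylinder K P j" "Inl -` \<sigma> = {}"
    by auto
  then have eq: "\<sigma> = Inr ` (Inr -` \<sigma>)"
    by (auto simp: image_iff) (metis Inr_not_Inl sumE vimageI2 empty_iff)
  moreover have "\<sigma> \<noteq> {}" "Inr -` \<sigma> \<subseteq> P" "chain\<^sub>\<subseteq> (Inr -` \<sigma>)"
    using \<sigma>(1) by (simp_all add: cylinder_def)
  ultimately have "Inr -` \<sigma> \<in> whitney_complex (phi P)"
    unfolding whitney_complex_phi_iff[OF assms] by (metis image_empty)
  with eq show "\<sigma> \<in> (`) Inr ` whitney_complex (phi P)"
    by blast
next
  fix \<sigma> :: "('a + 'b set) set"
  assume "\<sigma> \<in> (`) Inr ` whitney_complex (phi P)"
  then obtain c where c: "c \<in> whitney_complex (phi P)" "\<sigma> = Inr ` c"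
    by auto
  have "Inr -` \<sigma> = c" "Inl -` \<sigma> = {}"
    by (auto simp: c)
  then show "\<sigma> \<in> {\<sigma> \<in> cylinder K P j. Inl -` \<sigma> = {}}"
    using c by (auto simp: cylinder_def whitney_complex_phi_iff[OF assms])
qed

section \<open>Collapsing the cylinder onto the poset\<close>

text \<open>
  The length of the set of levels \<open>s \<in> {0..t}\<close> whose superlevel set \<open>{a \<in> V. s < y a}\<close> is exactly \<open>F\<close>.
  The \<open>0\<close> inserted into the maximum accounts for the levels starting at 0; it also gives a value when
  \<open>F\<close> is all of \<open>V\<close>.
\<close>
definition level_length :: "'a set \<Rightarrow> ('a \<Rightarrow> real) \<Rightarrow> 'a set \<Rightarrow> real \<Rightarrow> real" where
  "level_length V y F t = max 0 (min t (Min (y ` F)) - Max (insert 0 (y ` (V - F))))"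

lemma continuous_map_Max_insert_0:
  fixes f :: "'i \<Rightarrow> 'a \<Rightarrow> real"
  assumes "finite A" "\<And>a. a \<in> A \<Longrightarrow> continuous_map X euclideanreal (f a)"
  shows "continuous_map X euclideanreal (\<lambda>x. Max (insert 0 ((\<lambda>a. f a x) ` A)))"
  using assms
proof (induction rule: finite_induct)
  case (insert b A)
  have "Max (insert 0 ((\<lambda>a. f a x) ` insert b A)) = max (f b x) (Max (insert 0 ((\<lambda>a. f a x) ` A)))" for x
    using insert.hyps by (simp add: insert_commute[of 0])
  then show ?case
    using insert by (simp add: continuous_map_real_max)
qed simp

lemma continuous_map_level_length:
  assumes "finite V" "F \<subseteq> V" "F \<noteq> {}"
    and "\<And>a. continuous_map X euclideanreal (\<lambda>x. y x a)" "continuous_map X euclideanreal t"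
  shows "continuous_map X euclideanreal (\<lambda>x. level_length V (y x) F (t x))"
proof -
  have F: "finite F"
    using assms finite_subset by blast
  have "continuous_map X euclideanreal (\<lambda>x. Min (y x ` F))"
    using F assms by (intro continuous_map_Min[of F X "\<lambda>a x. y x a"]) auto
  moreover have "continuous_map X euclideanreal (\<lambda>x. Max (insert 0 (y x ` (V - F))))"
    using assms by (intro continuous_map_Max_insert_0[of "V - F" X "\<lambda>a x. y x a"]) auto
  ultimately show ?thesis
    unfolding level_length_def using assms(5) by (intro continuous_intros) auto
qed

lemma level_length_nonneg: "0 \<le> level_length V y F t"
  by (simp add: level_length_def)

text \<open>
  The last fact is what makes the flow below stay in the cylinder: a vertex that still has a positive
  coordinate at time \<open>t\<close> belonged to every superlevel set passed so far.
\<close>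
lemma level_length_posD:
  assumes "0 < level_length V y F t" "finite V" "F \<subseteq> V"
  shows "a \<in> F \<Longrightarrow> 0 < y a"
    and "\<lbrakk>a \<in> F; b \<in> V - F\<rbrakk> \<Longrightarrow> y b < y a"
    and "\<lbrakk>b \<in> V; t \<le> y b\<rbrakk> \<Longrightarrow> b \<in> F"
proof -
  have fin: "finite F"
    using assms finite_subset by blast
  have less: "Max (insert 0 (y ` (V - F))) < min t (Min (y ` F))"
    using assms(1) by (simp only: level_length_def less_max_iff_disj) simp
  have lower: "s \<le> Max (insert 0 (y ` (V - F)))" if "s \<in> insert 0 (y ` (V - F))" for s
    using that assms(2) by (intro Max_ge) auto
  have upper: "min t (Min (y ` F)) \<le> y a" if "a \<in> F" for a
    using that fin by (simp add: min.coboundedI2)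
  show "0 < y a" if "a \<in> F"
    using lower[OF insertI1] less upper[OF that] by linarith
  have y_lower: "y b \<le> Max (insert 0 (y ` (V - F)))" if "b \<in> V - F"
    using lower[of "y b"] that by blast
  show "y b < y a" if "a \<in> F" "b \<in> V - F"
    using y_lower[OF that(2)] less upper[OF that(1)] by linarith
  show "b \<in> F" if "b \<in> V" "t \<le> y b"
  proof (rule ccontr)
    assume "b \<notin> F"
    then have "y b < t"
      using y_lower that(1) less by simp
    with that show False by simp
  qed
qed

lemma level_length_nested:
  assumes "finite V" "F \<subseteq> V" "F' \<subseteq> V" "0 < level_length V y F t" "0 < level_length V y F' t"
  shows "F \<subseteq> F' \<or> F' \<subseteq> F"
proof (rule ccontr)
  assume "\<not> ?thesis"
  then obtain a b where "a \<in> F" "a \<notin> F'" "b \<in> F'" "b \<notin> F"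
    by blast
  then have "y b < y a" "y a < y b"
    using level_length_posD(2)[OF assms(4,1,2)] level_length_posD(2)[OF assms(5,1,3)] assms by auto
  then show False by simp
qed

text \<open>
  The set where \<open>y\<close> attains its maximum is a superlevel set for an interval of levels. This provides
  mass on the poset side once all coordinates on the complex have run out.
\<close>
lemma level_length_pos_exists:
  assumes V: "finite V" and y: "\<And>a. a \<in> V \<Longrightarrow> y a \<le> t" and pos: "b \<in> V" "0 < y b"
  shows "\<exists>F\<subseteq>V. F \<noteq> {} \<and> (\<forall>a\<in>F. 0 < y a) \<and> 0 < level_length V y F t"
proof -
  define M where "M = Max (y ` V)"
  define F where "F = {a \<in> V. y a = M}"
  have M_ge: "y a \<le> M" if "a \<in> V" for a
    using V that by (simp add: M_def)
  have "M \<in> y ` V"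
    unfolding M_def using V pos by (intro Max_in) auto
  then have F: "F \<noteq> {}" "finite F" and "M \<le> t"
    using V y by (auto simp: F_def)
  have "0 < M"
    using pos M_ge[OF pos(1)] by linarith
  moreover have "y a < M" if "a \<in> V - F" for a
    using M_ge[of a] that by (force simp: F_def)
  ultimately have "Max (insert 0 (y ` (V - F))) < M"
    using V by (subst Max_less_iff) auto
  moreover have "y ` F = {M}"
    using F(1) by (auto simp: F_def)
  ultimately have "0 < level_length V y F t"
    using \<open>M \<le> t\<close> by (simp add: level_length_def)
  then show ?thesis
    using F \<open>0 < M\<close> by (intro exI[of _ F]) (auto simp: F_def)
qed

text \<open>
  At time \<open>t\<close> the coordinates \<open>y\<close> on the complex have become \<open>max 0 (y - t)\<close>, and every \<open>p \<in> P\<close> has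
  received the length of the levels \<open>s \<le> t\<close> whose superlevel set is mapped to \<open>p\<close>. Superlevel sets
  decrease with \<open>s\<close>, hence so do their images: the images form a chain, lie below the chain that was
  present from the start, and contain \<open>j a\<close> for every vertex \<open>a\<close> that survives up to time \<open>t\<close>.
  Coordinates are at most 1, so at time 1 nothing is left on the complex. Points of the order complex
  stay fixed throughout. A level at which \<open>n\<close> vertices lose mass adds only once to the poset side, so
  the total mass is not constant and is normalised.
\<close>
lemma cylinder_homotopy_equivalent_order_complex:
  assumes K: "finite_abstract_simplicial_complex K" and P: "finite P"
    and j: "\<And>F. F \<in> K \<Longrightarrow> \<Union>(j ` F) \<in> P"
  shows "geometric_realization (cylinder K P j) homotopy_equivalent_space
         geometric_realization (whitney_complex (phi P))"
proof -
  define V where "V = \<Union>K"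
  define W where "W = V <+> P"
  define Z where "Z = cylinder K P j"
  define Z' where "Z' = {\<sigma> \<in> Z. Inl -` \<sigma> = {}}"
  have V: "finite V"
    unfolding V_def by (rule complex_finite_vertices[OF K])
  have KV: "F \<subseteq> V" "F \<noteq> {}" if "F \<in> K" for F
    using that complex_nonempty[OF K] by (auto simp: V_def)
  have finK: "finite K"
    using K by (simp add: finite_abstract_simplicial_complex_def)
  have W: "finite W" "\<Union>Z \<subseteq> W" "\<Union>Z' \<subseteq> W"
    using V P cylinder_vertices[of K P j] by (auto simp: W_def V_def Z_def Z'_def)
  define y where "y z = (\<lambda>a. z (Inl a))" for z :: "'a + 'b set \<Rightarrow> real"
  define mass where "mass t z w =
      (case w of Inl a \<Rightarrow> max 0 (z w - t)
       | Inr p \<Rightarrow> z w + (\<Sum>F\<in>{F \<in> K. \<Union>(j ` F) = p}. level_length V (y z) F t))" for t z w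
  define flow where "flow = (\<lambda>(t, z) w. mass t z w / sum (mass t z) W)"
  have mass: "0 \<le> mass t z w" "supp (mass t z) \<in> Z" "0 < sum (mass t z) W"
    if t: "0 \<le> t" and zZ: "z \<in> topspace (geometric_realization Z)" for t z w
  proof -
    have z: "\<forall>w. 0 \<le> z w" "supp z \<in> Z" "sum z W = 1"
      using zZ topspace_geometric_realization[OF W(1,2)] by auto
    have nonneg: "0 \<le> mass t z w" for w
      using z(1) level_length_nonneg[of V "y z" _ t]
      by (cases w) (auto simp: mass_def intro!: add_nonneg_nonneg sum_nonneg)
    then show "0 \<le> mass t z w" .
    have lp: "\<exists>F\<in>K. \<Union>(j ` F) = p \<and> 0 < level_length V (y z) F t"
      if "mass t z (Inr p) \<noteq> 0" "z (Inr p) = 0" for p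
    proof -
      have "(\<Sum>F\<in>{F \<in> K. \<Union>(j ` F) = p}. level_length V (y z) F t) \<noteq> 0"
        using that by (simp add: mass_def)
      then obtain F where F: "F \<in> {F \<in> K. \<Union>(j ` F) = p}" "level_length V (y z) F t \<noteq> 0"
        by (rule sum.not_neutral_contains_not_neutral)
      then have "0 < level_length V (y z) F t"
        using level_length_nonneg[of V "y z" F t] by simp
      with F(1) show ?thesis
        by blast
    qed
    have zK: "Inl -` supp z \<in> insert {} K" "Inr -` supp z \<subseteq> P" "chain\<^sub>\<subseteq> (Inr -` supp z)"
         "\<And>a p. z (Inl a) \<noteq> 0 \<Longrightarrow> z (Inr p) \<noteq> 0 \<Longrightarrow> j a \<subseteq> p"
      using z(2) by (auto simp: Z_def cylinder_def)
    have left: "z (Inl a) > t" "a \<in> V" if "mass t z (Inl a) \<noteq> 0" for a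
    proof -
      show "z (Inl a) > t"
        using that by (simp add: mass_def split: if_splits)
      then have "a \<in> Inl -` supp z"
        using t by auto
      then show "a \<in> V"
        using zK(1) by (auto simp: V_def)
    qed
    have lower: "\<Union>(j ` F) \<subseteq> p"
      if "F \<in> K" "0 < level_length V (y z) F t" "z (Inr p) \<noteq> 0" for F p
      using level_length_posD(1)[OF that(2) V KV(1)[OF that(1)]] zK(4)[OF _ that(3)]
      unfolding y_def by (metis UN_least less_numeral_extra(3))
    have right: "(z (Inr p) \<noteq> 0) \<or> (\<exists>F\<in>K. \<Union>(j ` F) = p \<and> 0 < level_length V (y z) F t)"
      if "mass t z (Inr p) \<noteq> 0" for p
      using lp[OF that] by blast
    \<comment> \<open>Unless some element of \<open>P\<close> had mass from the start or some coordinate on \<open>K\<close> exceeds \<open>t\<close>,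
      the image of the set where the coordinates on \<open>K\<close> are maximal has received mass.\<close>
    have pos: "\<exists>w\<in>W. 0 < mass t z w"
    proof (cases "\<exists>w\<in>W. z w \<noteq> 0 \<and> (\<forall>a. w = Inl a \<longrightarrow> t < z w)")
      case True
      then obtain w where w: "w \<in> W" "z w \<noteq> 0" "\<forall>a. w = Inl a \<longrightarrow> t < z w"
        by blast
      have "0 < mass t z w"
      proof (cases w)
        case (Inl a)
        then show ?thesis using w by (simp add: mass_def)
      next
        case (Inr p)
        have "0 < z w"
          using w(2) z(1) by (metis order_le_less)
        then show ?thesis
          using level_length_nonneg[of V "y z" _ t]
          by (simp add: mass_def Inr add_pos_nonneg sum_nonneg)
      qed
      with w show ?thesis by blast
    next
      case False
      have "\<exists>w\<in>W. z w \<noteq> 0"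
        using z(3) by (metis sum.neutral zero_neq_one)
      then obtain w where w: "w \<in> W" "z w \<noteq> 0" by blast
      with False obtain b where b: "w = Inl b" by blast
      have "b \<in> V"
        using w b by (auto simp: W_def)
      have y_le: "y z a \<le> t" if "a \<in> V" for a
        using False that t unfolding y_def W_def by (cases "z (Inl a) = 0") force+
      have y_pos: "0 < y z b"
        using w b z(1) by (metis order_le_less y_def)
      obtain F where F: "F \<subseteq> V" "F \<noteq> {}" "\<forall>a\<in>F. 0 < y z a" "0 < level_length V (y z) F t"
        using level_length_pos_exists[of V "y z" t b, OF V y_le \<open>b \<in> V\<close> y_pos] by metis
      have "F \<subseteq> Inl -` supp z"
        using F(3) by (force simp: y_def)
      then have FK: "F \<in> K"
        using complex_face_or_empty[OF K zK(1)] F(2) by blast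
      have "level_length V (y z) F t \<le> (\<Sum>F'\<in>{F' \<in> K. \<Union>(j ` F') = \<Union>(j ` F)}. level_length V (y z) F' t)"
        using FK finK level_length_nonneg by (intro member_le_sum) auto
      then have "0 < mass t z (Inr (\<Union>(j ` F)))"
        using F(4) z(1) by (simp add: mass_def add_nonneg_pos)
      then show ?thesis
        using j[OF FK] by (auto simp: W_def)
    qed
    then show "0 < sum (mass t z) W"
      using sum_pos2[OF W(1)] nonneg by metis
    have "supp (mass t z) \<noteq> {}"
      using pos by force
    moreover have "Inl -` supp (mass t z) \<in> insert {} K"
    proof -
      have "Inl -` supp (mass t z) \<subseteq> Inl -` supp z"
        using left(1) t by force
      then show ?thesis
        by (rule complex_face_or_empty[OF K zK(1)])
    qed
    moreover have "Inr -` supp (mass t z) \<subseteq> P"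
      using right zK(2) j by fastforce
    moreover have "chain\<^sub>\<subseteq> (Inr -` supp (mass t z))"
      unfolding chain_subset_def
    proof (intro ballI)
      fix p q
      assume "p \<in> Inr -` supp (mass t z)" "q \<in> Inr -` supp (mass t z)"
      then have pq: "mass t z (Inr p) \<noteq> 0" "mass t z (Inr q) \<noteq> 0"
        by auto
      consider "z (Inr p) \<noteq> 0" "z (Inr q) \<noteq> 0"
        | F where "F \<in> K" "\<Union>(j ` F) = p" "0 < level_length V (y z) F t" "z (Inr q) \<noteq> 0"
        | F where "F \<in> K" "\<Union>(j ` F) = q" "0 < level_length V (y z) F t" "z (Inr p) \<noteq> 0"
        | F F' where "F \<in> K" "\<Union>(j ` F) = p" "0 < level_length V (y z) F t"
            "F' \<in> K" "\<Union>(j ` F') = q" "0 < level_length V (y z) F' t"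
        using right[OF pq(1)] right[OF pq(2)] by blast
      then show "p \<subseteq> q \<or> q \<subseteq> p"
      proof cases
        case 1
        then show ?thesis
          using zK(3) by (auto simp: chain_subset_def)
      next
        case 2
        then show ?thesis using lower by blast
      next
        case 3
        then show ?thesis using lower by blast
      next
        case 4
        then have "F \<subseteq> F' \<or> F' \<subseteq> F"
          using level_length_nested[OF V] KV by blast
        then show ?thesis
          using 4 by blast
      qed
    qed
    moreover have "j a \<subseteq> p" if "mass t z (Inl a) \<noteq> 0" "mass t z (Inr p) \<noteq> 0" for a p
      using right[OF that(2)]
    proof
      assume "z (Inr p) \<noteq> 0"
      then show ?thesis
        using zK(4) left(1)[OF that(1)] t by force
    next
      assume "\<exists>F\<in>K. \<Union>(j ` F) = p \<and> 0 < level_length V (y z) F t"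
      then obtain F where F: "F \<in> K" "\<Union>(j ` F) = p" "0 < level_length V (y z) F t"
        by blast
      have "a \<in> F"
        using level_length_posD(3)[OF F(3) V KV(1)[OF F(1)], of a] left[OF that(1)]
        by (simp add: y_def)
      then show ?thesis
        using F(2) by blast
    qed
    ultimately show "supp (mass t z) \<in> Z"
      unfolding Z_def cylinder_def by blast
  qed
  have supp_flow: "supp (flow (t, z)) = supp (mass t z)"
    if "0 \<le> t" "z \<in> topspace (geometric_realization Z)" for t z
    using mass(3)[OF that] by (auto simp: flow_def)
  have flow_point: "0 \<le> flow (t, z) w" "supp (flow (t, z)) \<in> Z" "sum (flow (t, z)) W = 1"
    if "0 \<le> t" "z \<in> topspace (geometric_realization Z)" for t z w
    using mass(1,3)[OF that] mass(2)[OF that] supp_flow[OF that]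
    by (auto simp: flow_def simp flip: sum_divide_distrib intro: divide_nonneg_pos)
  have flow_ident: "flow (t, z) = z"
    if z: "z \<in> topspace (geometric_realization Z)"
      and t: "t = 0 \<or> (0 \<le> t \<and> (\<forall>a. z (Inl a) = 0))" for t z
  proof -
    have z: "\<forall>w. 0 \<le> z w" "sum z W = 1"
      using z topspace_geometric_realization[OF W(1,2)] by auto
    have "level_length V (y z) F t = 0" if F: "F \<in> K" for F
    proof (rule ccontr)
      assume "\<not> ?thesis"
      then have pos: "0 < level_length V (y z) F t"
        using level_length_nonneg[of V "y z" F t] by simp
      obtain a where a: "a \<in> F"
        using KV(2)[OF F] by blast
      have "0 < z (Inl a)"
        using level_length_posD(1)[OF pos V KV(1)[OF F] a] by (simp add: y_def)
      then have "t = 0"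
        using t by fastforce
      moreover have "0 \<le> Max (insert 0 (y z ` (V - F)))"
        using V by (intro Max_ge) auto
      ultimately show False
        using pos by (simp add: level_length_def split: if_splits)
    qed
    then have "mass t z w = z w" for w
      using t z(1) by (cases w) (auto simp: mass_def)
    then show ?thesis
      using z(2) by (simp add: flow_def)
  qed
  have cont_flow: "continuous_map X (geometric_realization Y) (\<lambda>x. flow (f x, g x))"
    if f: "continuous_map X euclideanreal f" "\<And>x. x \<in> topspace X \<Longrightarrow> 0 \<le> f x"
      and g: "continuous_map X (geometric_realization Z) g"
      and Y: "\<Union>Y \<subseteq> W" "\<And>x. x \<in> topspace X \<Longrightarrow> supp (flow (f x, g x)) \<in> Y"
    for f X Y and g :: "'c \<Rightarrow> 'a + 'b set \<Rightarrow> real"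
  proof (rule continuous_map_into_geometric_realization[OF W(1) Y(1)])
    have g_coord: "continuous_map X euclideanreal (\<lambda>x. g x w)" for w
      using continuous_map_compose[OF g continuous_map_coordinate[of Z w]] by (simp add: o_def)
    have gZ: "g x \<in> topspace (geometric_realization Z)" if "x \<in> topspace X" for x
      using continuous_map_funspace[OF g] that by blast
    have "continuous_map X euclideanreal (\<lambda>x. level_length V (y (g x)) F (f x))" if "F \<in> K" for F
      by (intro continuous_map_level_length V KV that f) (simp add: y_def g_coord)
    then have "continuous_map X euclideanreal (\<lambda>x. mass (f x) (g x) w)" for w
      using g_coord f finK by (cases w) (auto simp: mass_def intro!: continuous_intros)
    then show "continuous_map X euclideanreal (\<lambda>x. flow (f x, g x) w)" for w
      using mass(3)[OF f(2) gZ] W(1) unfolding flow_def case_prod_conv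
      by (intro continuous_intros) force+
    show "0 \<le> flow (f x, g x) w" "sum (flow (f x, g x)) W = 1" if "x \<in> topspace X" for x w
      using flow_point[OF f(2)[OF that] gZ[OF that]] by auto
  qed (use Y in auto)
  have id_cont: "continuous_map (geometric_realization Z) (geometric_realization Z) (\<lambda>z. z)"
    by (metis continuous_map_id id_def eq_id_iff)
  have into_Z': "supp (flow (1, z)) \<in> Z'" if "z \<in> topspace (geometric_realization Z)" for z
  proof -
    have z: "\<forall>w. 0 \<le> z w" "sum z W = 1" "supp z \<in> Z"
      using that topspace_geometric_realization[OF W(1,2)] by auto
    have "z (Inl a) \<le> 1" for a
    proof (cases "Inl a \<in> W")
      case True
      then show ?thesis
        using member_le_sum[of "Inl a" W z] z W(1) by auto
    next
      case False
      then have "z (Inl a) = 0"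
        using z(3) W(2) by blast
      then show ?thesis by simp
    qed
    then have "mass 1 z (Inl a) = 0" for a
      by (simp add: mass_def)
    then show ?thesis
      using supp_flow[OF _ that, of 1] mass(2)[OF _ that, of 1] by (auto simp: Z'_def)
  qed
  have retract: "flow (1, z) = z" "z \<in> topspace (geometric_realization Z)"
    if "z \<in> topspace (geometric_realization Z')" for z
  proof -
    have z: "\<forall>w. 0 \<le> z w" "sum z W = 1" "supp z \<in> Z'"
      using that topspace_geometric_realization[OF W(1,3)] by auto
    then show zZ: "z \<in> topspace (geometric_realization Z)"
      using topspace_geometric_realization[OF W(1,2)] by (auto simp: Z'_def)
    show "flow (1, z) = z"
      using z(3) by (intro flow_ident[OF zZ]) (auto simp: Z'_def)
  qed
  have "retraction_maps (geometric_realization Z) (geometric_realization Z') (\<lambda>z. flow (1, z)) id"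
    unfolding retraction_maps_def
  proof (intro conjI ballI)
    show "continuous_map (geometric_realization Z) (geometric_realization Z') (\<lambda>z. flow (1, z))"
      by (rule cont_flow[OF _ _ id_cont W(3)]) (use into_Z' in auto)
    show "continuous_map (geometric_realization Z') (geometric_realization Z) id"
    proof (rule continuous_map_into_geometric_realization[OF W(1,2)])
      fix z
      assume "z \<in> topspace (geometric_realization Z')"
      note retract(2)[OF this]
      then show "0 \<le> id z w" "supp (id z) \<in> Z" "sum (id z) W = 1" for w
        using topspace_geometric_realization[OF W(1,2)] by auto
    qed (simp add: continuous_map_coordinate)
  qed (simp add: retract)
  moreover have "homotopic_with (\<lambda>_. True) (geometric_realization Z) (geometric_realization Z)
      (\<lambda>z. flow (1, z)) id"
  proof -
    have "continuous_map (prod_topology (top_of_set {0..1::real}) (geometric_realization Z)) euclideanreal fst"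
      by (meson continuous_map_fst continuous_map_into_fulltopology)
    then have "continuous_map (prod_topology (top_of_set {0..1}) (geometric_realization Z))
        (geometric_realization Z) (\<lambda>x. flow (fst x, snd x))"
      by (intro cont_flow continuous_map_snd W(2)) (use flow_point in auto)
    then have "homotopic_with (\<lambda>_. True) (geometric_realization Z) (geometric_realization Z) id
        (\<lambda>z. flow (1, z))"
      by (subst homotopic_with, simp, intro exI[of _ flow]) (simp add: flow_ident)
    then show ?thesis
      by (rule homotopic_with_symD)
  qed
  ultimately have "geometric_realization Z homotopy_equivalent_space geometric_realization Z'"
    by (rule deformation_retract_imp_homotopy_equivalent_space[rotated])
  moreover have "geometric_realization Z' homotopy_equivalent_space
      geometric_realization (whitney_complex (phi P))"
    unfolding Z'_def Z_def cylinder_top[OF P]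
    by (rule homotopy_equivalent_isomorphic_complex
        [OF finite_abstract_simplicial_complex_whitney_complex[OF pair_graph_phi[OF P]]]) simp
  ultimately show ?thesis
    unfolding Z_def by (rule homotopy_eqv_trans)
qed


section \<open>Collapsing the cylinder onto the complex\<close>

text \<open>
  The subcomplex of \<open>K\<close> spanned by \<open>V\<close> becomes a cone after successive deletion of dominated vertices.
  It is described by its vertex set so that one complex \<open>K\<close> serves for all stages. The empty face in
  the rule for cones says that the apex is itself a vertex of \<open>K\<close>.
\<close>
inductive dismantlable :: "'a set set \<Rightarrow> 'a set \<Rightarrow> bool" for K where
  cone: "\<lbrakk>u \<in> V; \<And>F. \<lbrakk>F \<in> insert {} K; F \<subseteq> V\<rbrakk> \<Longrightarrow> insert u F \<in> K\<rbrakk> \<Longrightarrow> dismantlable K V"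
| dominated: "\<lbrakk>w \<in> V; u \<in> V - {w}; \<And>F. \<lbrakk>F \<in> K; F \<subseteq> V; w \<in> F\<rbrakk> \<Longrightarrow> insert u F \<in> K;
     dismantlable K (V - {w})\<rbrakk> \<Longrightarrow> dismantlable K V"

text \<open>
  Deleting a vertex \<open>w\<close> of the fiber that is dominated by \<open>u\<close> corresponds to deleting the edge between
  \<open>Inr q\<close> and \<open>Inl w\<close>, whose link is a cone with apex \<open>Inl u\<close>. When the fiber has become a cone, its
  apex dominates \<open>Inr q\<close>, and \<open>Inr q\<close> itself can go.
\<close>
lemma homotopy_equivalent_delete_dismantlable_link:
  fixes Z :: "('a + 'b) set set"
  assumes "dismantlable K V" and Z: "finite_abstract_simplicial_complex Z"
    and base: "\<And>\<sigma>. \<sigma> \<in> Z \<Longrightarrow> Inl -` \<sigma> \<in> insert {} K"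
    and "\<And>\<sigma> u. \<lbrakk>\<sigma> \<in> Z; Inr q \<in> \<sigma>; Inl -` \<sigma> \<subseteq> V; u \<in> V; insert u (Inl -` \<sigma>) \<in> K\<rbrakk>
           \<Longrightarrow> insert (Inl u) \<sigma> \<in> Z"
  shows "geometric_realization {\<sigma> \<in> Z. Inr q \<in> \<sigma> \<longrightarrow> Inl -` \<sigma> \<subseteq> V} homotopy_equivalent_space
         geometric_realization {\<sigma> \<in> Z. Inr q \<notin> \<sigma>}"
  using assms(1,4)
proof (induction V)
  case (cone u V)
  define ZV where "ZV = {\<sigma> \<in> Z. Inr q \<in> \<sigma> \<longrightarrow> Inl -` \<sigma> \<subseteq> V}"
  have "geometric_realization ZV homotopy_equivalent_space
        geometric_realization {\<sigma> \<in> ZV. \<not> {Inr q} \<subseteq> \<sigma>}"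
  proof (rule homotopy_equivalent_delete_star[where u = "Inl u"])
    show "finite_abstract_simplicial_complex ZV"
      unfolding ZV_def by (rule complex_restrict_star[OF Z])
    fix \<sigma>
    assume "\<sigma> \<in> ZV" "{Inr q} \<subseteq> \<sigma>"
    then have \<sigma>: "\<sigma> \<in> Z" "Inr q \<in> \<sigma>" "Inl -` \<sigma> \<subseteq> V"
      by (auto simp: ZV_def)
    then have "insert u (Inl -` \<sigma>) \<in> K"
      using cone.hyps(2) base by blast
    then have "insert (Inl u) \<sigma> \<in> Z"
      using cone.prems \<sigma> cone.hyps(1) by blast
    moreover have "Inl -` insert (Inl u) \<sigma> \<subseteq> V"
      using \<sigma>(3) cone.hyps(1) by auto
    ultimately show "insert (Inl u) \<sigma> \<in> ZV"
      by (simp add: ZV_def)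
  qed auto
  moreover have "{\<sigma> \<in> ZV. \<not> {Inr q} \<subseteq> \<sigma>} = {\<sigma> \<in> Z. Inr q \<notin> \<sigma>}"
    by (auto simp: ZV_def)
  ultimately show ?case
    by (simp add: ZV_def)
next
  case (dominated w V u)
  define ZV where "ZV = {\<sigma> \<in> Z. Inr q \<in> \<sigma> \<longrightarrow> Inl -` \<sigma> \<subseteq> V}"
  have "geometric_realization ZV homotopy_equivalent_space
        geometric_realization {\<sigma> \<in> ZV. \<not> {Inr q, Inl w} \<subseteq> \<sigma>}"
  proof (rule homotopy_equivalent_delete_star[where u = "Inl u"])
    show "finite_abstract_simplicial_complex ZV"
      unfolding ZV_def by (rule complex_restrict_star[OF Z])
    show "Inl u \<notin> {Inr q, Inl w}"
      using dominated.hyps(2) by auto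
    fix \<sigma>
    assume "\<sigma> \<in> ZV" "{Inr q, Inl w} \<subseteq> \<sigma>"
    then have \<sigma>: "\<sigma> \<in> Z" "Inr q \<in> \<sigma>" "Inl -` \<sigma> \<subseteq> V" "w \<in> Inl -` \<sigma>"
      by (auto simp: ZV_def)
    then have "insert u (Inl -` \<sigma>) \<in> K"
      using dominated.hyps(3) base by blast
    then have "insert (Inl u) \<sigma> \<in> Z"
      using dominated.prems \<sigma> dominated.hyps(2) by blast
    moreover have "Inl -` insert (Inl u) \<sigma> \<subseteq> V"
      using \<sigma>(3) dominated.hyps(2) by auto
    ultimately show "insert (Inl u) \<sigma> \<in> ZV"
      by (simp add: ZV_def)
  qed auto
  moreover have "{\<sigma> \<in> ZV. \<not> {Inr q, Inl w} \<subseteq> \<sigma>} = {\<sigma> \<in> Z. Inr q \<in> \<sigma> \<longrightarrow> Inl -` \<sigma> \<subseteq> V - {w}}"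
    by (auto simp: ZV_def)
  moreover have "geometric_realization {\<sigma> \<in> Z. Inr q \<in> \<sigma> \<longrightarrow> Inl -` \<sigma> \<subseteq> V - {w}}
      homotopy_equivalent_space geometric_realization {\<sigma> \<in> Z. Inr q \<notin> \<sigma>}"
    by (rule dominated.IH) (use dominated.prems in \<open>auto simp: subset_Diff_insert\<close>)
  ultimately show ?case
    unfolding ZV_def by (metis (no_types, lifting) homotopy_eqv_trans)
qed

text \<open>
  A minimal element \<open>h\<close> of what remains of \<open>P\<close> is adjacent only to the fiber over \<open>h\<close> and to elements
  above \<open>h\<close>; the latter are above the whole fiber and do not interfere with its dismantling.
\<close>
lemma cylinder_homotopy_equivalent_base:
  fixes j :: "'a \<Rightarrow> 'b set"
  assumes K: "finite_abstract_simplicial_complex K" and "finite P"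
    and "\<And>p. p \<in> P \<Longrightarrow> dismantlable K {a \<in> \<Union>K. j a \<subseteq> p}"
  shows "geometric_realization (cylinder K P j) homotopy_equivalent_space geometric_realization K"
  using assms(2,3)
proof (induction P rule: finite_psubset_induct)
  case (psubset P)
  show ?case
  proof (cases "P = {}")
    case True
    then show ?thesis
      unfolding True cylinder_empty_base[OF K]
      by (intro homotopy_equivalent_isomorphic_complex[OF K]) simp
  next
    case False
    then obtain h where h: "h \<in> P" and minimal: "\<And>p. \<lbrakk>p \<in> P; p \<subseteq> h\<rbrakk> \<Longrightarrow> p = h"
      using finite_has_minimal[OF psubset.hyps] by metis
    define Z where "Z = cylinder K P j"
    define V where "V = {a \<in> \<Union>K. j a \<subseteq> h}"
    have star: "Inl -` \<sigma> \<subseteq> V" if "\<sigma> \<in> Z" "Inr h \<in> \<sigma>" for \<sigma>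
      using that by (auto simp: Z_def V_def cylinder_def)
    have Z_eq: "{\<sigma> \<in> Z. Inr h \<in> \<sigma> \<longrightarrow> Inl -` \<sigma> \<subseteq> V} = Z"
      using star by auto
    have Z'_eq: "{\<sigma> \<in> Z. Inr h \<notin> \<sigma>} = cylinder K (P - {h}) j"
      by (auto simp: Z_def cylinder_def)
    have "geometric_realization {\<sigma> \<in> Z. Inr h \<in> \<sigma> \<longrightarrow> Inl -` \<sigma> \<subseteq> V} homotopy_equivalent_space
          geometric_realization {\<sigma> \<in> Z. Inr h \<notin> \<sigma>}"
    proof (rule homotopy_equivalent_delete_dismantlable_link)
      show "dismantlable K V"
        unfolding V_def by (rule psubset.prems[OF h])
      show "finite_abstract_simplicial_complex Z"
        unfolding Z_def by (rule complex_cylinder[OF K psubset.hyps])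
      show "Inl -` \<sigma> \<in> insert {} K" if "\<sigma> \<in> Z" for \<sigma>
        using that by (simp add: Z_def cylinder_def)
      fix \<sigma> u
      assume \<sigma>: "\<sigma> \<in> Z" "Inr h \<in> \<sigma>" and u: "u \<in> V" "insert u (Inl -` \<sigma>) \<in> K"
      have c: "Inr -` \<sigma> \<subseteq> P" "chain\<^sub>\<subseteq> (Inr -` \<sigma>)" "\<forall>a\<in>Inl -` \<sigma>. \<forall>p\<in>Inr -` \<sigma>. j a \<subseteq> p"
        using \<sigma>(1) by (simp_all add: Z_def cylinder_def)
      have "j u \<subseteq> p" if "p \<in> Inr -` \<sigma>" for p
      proof -
        have "p \<subseteq> h \<or> h \<subseteq> p" "p \<in> P"
          using c that \<sigma>(2) unfolding chain_subset_def by blast+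
        then have "h \<subseteq> p"
          using minimal by blast
        then show ?thesis
          using u(1) by (auto simp: V_def)
      qed
      moreover have "Inl -` insert (Inl u) \<sigma> = insert u (Inl -` \<sigma>)" "Inr -` insert (Inl u) \<sigma> = Inr -` \<sigma>"
        by auto
      ultimately show "insert (Inl u) \<sigma> \<in> Z"
        using c u(2) by (simp add: Z_def cylinder_def)
    qed
    then have "geometric_realization (cylinder K P j) homotopy_equivalent_space
               geometric_realization (cylinder K (P - {h}) j)"
      by (simp only: Z_eq Z'_eq) (simp only: Z_def)
    moreover have "geometric_realization (cylinder K (P - {h}) j) homotopy_equivalent_space
                   geometric_realization K"
      using h psubset.prems by (intro psubset.IH) auto
    ultimately show ?thesis
      by (rule homotopy_eqv_trans)
  qed
qed

text \<open>
  Dismantlability of the fibers takes the place of contractibility in Quillen's theorem; it is what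
  makes an explicit homotopy possible.
\<close>
theorem homotopy_equivalent_order_complex:
  fixes j :: "'a \<Rightarrow> 'b set"
  assumes "finite_abstract_simplicial_complex K" "finite P"
    and "\<And>F. F \<in> K \<Longrightarrow> \<Union>(j ` F) \<in> P"
    and "\<And>p. p \<in> P \<Longrightarrow> dismantlable K {a \<in> \<Union>K. j a \<subseteq> p}"
  shows "geometric_realization K homotopy_equivalent_space
         geometric_realization (whitney_complex (phi P))"
proof (rule homotopy_eqv_trans)
  show "geometric_realization K homotopy_equivalent_space geometric_realization (cylinder K P j)"
    by (rule iffD1[OF homotopy_equivalent_space_sym
        cylinder_homotopy_equivalent_base[OF assms(1,2,4)]])
  show "geometric_realization (cylinder K P j) homotopy_equivalent_space
        geometric_realization (whitney_complex (phi P))"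
    by (rule cylinder_homotopy_equivalent_order_complex[OF assms(1,2,3)])
qed

section \<open>Barycentric subdivision\<close>

text \<open>
  Here \<open>\<Union>(j ` F) = F\<close>, and the fiber over a face is that face with all of its subsets, a cone over
  any of its vertices.
\<close>
lemma homotopy_equivalent_barycentric_subdivision:
  assumes K: "finite_abstract_simplicial_complex K"
  shows "geometric_realization K homotopy_equivalent_space graph_realization (phi K)"
  unfolding graph_realization_def
proof (rule homotopy_equivalent_order_complex[where j = "\<lambda>v. {v}"])
  show "finite K"
    using K by (simp add: finite_abstract_simplicial_complex_def)
  show "(\<Union>v\<in>F. {v}) \<in> K" if "F \<in> K" for F
    using that by simp
  fix p
  assume p: "p \<in> K"
  then obtain u where "u \<in> p"
    using complex_nonempty[OF K] by blast
  moreover have "{a \<in> \<Union>K. {a} \<subseteq> p} = p"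
    using p by auto
  ultimately show "dismantlable K {a \<in> \<Union>K. {a} \<subseteq> p}"
    using complex_face[OF K p] by (auto intro!: dismantlable.cone[of u])
qed (rule K)

section \<open>Dismantling families of chains\<close>

text \<open>
  The vertices outside \<open>V'\<close> can be deleted in any order, because their dominating vertices \<open>f w\<close> lie
  in \<open>V'\<close> and stay.
\<close>
lemma dismantlable_retract:
  assumes "finite (V - V')" "V' \<subseteq> V"
    and "\<And>w. w \<in> V - V' \<Longrightarrow> f w \<in> V'"
    and "\<And>w F. \<lbrakk>w \<in> V - V'; F \<in> K; F \<subseteq> V; w \<in> F\<rbrakk> \<Longrightarrow> insert (f w) F \<in> K"
    and dis: "dismantlable K V'"
  shows "dismantlable K V"
proof -
  have "dismantlable K (V' \<union> D)" if "finite D" "D \<subseteq> V - V'" for D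
    using that
  proof (induction D rule: finite_induct)
    case (insert w D)
    have eq: "V' \<union> insert w D - {w} = V' \<union> D"
      using insert by auto
    show ?case
    proof (rule dismantlable.dominated[of w _ "f w"])
      show "f w \<in> V' \<union> insert w D - {w}"
        using assms(3)[of w] insert.prems by auto
      show "insert (f w) F \<in> K" if "F \<in> K" "F \<subseteq> V' \<union> insert w D" "w \<in> F" for F
        using that insert.prems assms(2) by (intro assms(4)) auto
      show "dismantlable K (V' \<union> insert w D - {w})"
        using insert unfolding eq by auto
    qed auto
  qed (simp add: dis)
  from this[OF assms(1) order_refl] show ?thesis
    using assms(2) by (simp add: Un_absorb1)
qed

lemma whitney_complex_psi_iff:
  assumes "finite G" "{} \<notin> G"
  shows "F \<in> whitney_complex (psi G) \<longleftrightarrow>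
           F \<noteq> {} \<and> F \<subseteq> G \<and> (\<forall>A\<in>F. \<forall>B\<in>F. A \<inter> B \<noteq> {})"
proof -
  have "pairwise (\<lambda>A B. (A, B) \<in> parcs (psi G)) F \<longleftrightarrow> (\<forall>A\<in>F. \<forall>B\<in>F. A \<inter> B \<noteq> {})"
    if "F \<subseteq> G"
  proof
    assume *: "pairwise (\<lambda>A B. (A, B) \<in> parcs (psi G)) F"
    show "\<forall>A\<in>F. \<forall>B\<in>F. A \<inter> B \<noteq> {}"
    proof (intro ballI)
      fix A B
      assume "A \<in> F" "B \<in> F"
      then show "A \<inter> B \<noteq> {}"
        using * that assms(2) by (cases "A = B") (auto simp: pairwise_def psi_def)
    qed
  next
    assume "\<forall>A\<in>F. \<forall>B\<in>F. A \<inter> B \<noteq> {}"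
    then show "pairwise (\<lambda>A B. (A, B) \<in> parcs (psi G)) F"
      using that by (auto simp: pairwise_def psi_def subset_iff)
  qed
  then show ?thesis
    unfolding whitney_complex_iff[OF pair_graph_psi[OF assms(1)]]
    by (auto simp: psi_def)
qed

lemma dismantlable_retract_psi:
  assumes G: "finite G" "{} \<notin> G" and V: "V' \<subseteq> V" "V \<subseteq> G"
    and f: "\<And>A. A \<in> V - V' \<Longrightarrow> f A \<in> V'"
    and meets: "\<And>A B. \<lbrakk>A \<in> V - V'; B \<in> V; A \<inter> B \<noteq> {}\<rbrakk> \<Longrightarrow> f A \<inter> B \<noteq> {}"
    and dis: "dismantlable (whitney_complex (psi G)) V'"
  shows "dismantlable (whitney_complex (psi G)) V"
proof (rule dismantlable_retract[OF _ V(1) f _ dis])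
  show "finite (V - V')"
    using G V finite_subset by blast
  fix A F
  assume A: "A \<in> V - V'" "A \<in> F" and F: "F \<in> whitney_complex (psi G)" "F \<subseteq> V"
  have fA: "f A \<in> G"
    using f[OF A(1)] V by blast
  have "f A \<inter> B \<noteq> {}" if "B \<in> F" for B
    using meets[OF A(1)] that A(2) F by (auto simp: whitney_complex_psi_iff[OF G])
  then show "insert (f A) F \<in> whitney_complex (psi G)"
    using F(1) fA G(2) unfolding whitney_complex_psi_iff[OF G] by (auto simp: Int_commute)
qed auto

text \<open>Finite non-empty chains have \<open>\<Inter>A\<close> as minimum and \<open>\<Union>A\<close> as maximum.\<close>
lemma chain_Inter_mem:
  assumes "finite A" "A \<noteq> {}" "chain\<^sub>\<subseteq> A"
  shows "\<Inter>A \<in> A"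
  using assms
proof (induction rule: finite_ne_induct)
  case (insert x A)
  then have "\<Inter>A \<in> A"
    by (simp add: chain_subset_def)
  moreover from this have "x \<subseteq> \<Inter>A \<or> \<Inter>A \<subseteq> x"
    using insert.prems by (simp add: chain_subset_def)
  ultimately show ?case
    by (auto simp: Int_absorb1 Int_absorb2)
qed simp

lemma chain_Union_mem:
  assumes "finite A" "A \<noteq> {}" "chain\<^sub>\<subseteq> A"
  shows "\<Union>A \<in> A"
  using assms
proof (induction rule: finite_ne_induct)
  case (insert x A)
  then have "\<Union>A \<in> A"
    by (simp add: chain_subset_def)
  moreover from this have "x \<subseteq> \<Union>A \<or> \<Union>A \<subseteq> x"
    using insert.prems by (simp add: chain_subset_def)
  ultimately show ?case
    by (auto simp: Un_absorb1 Un_absorb2)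
qed simp

text \<open>
  In the chains that make up \<open>U k\<close>, members of cardinality less than \<open>k\<close> are already contained in \<open>h\<close>.
  Since the members of a chain have distinct cardinalities, a chain in \<open>U k\<close> has at most one member
  \<open>x\<close> of cardinality \<open>k\<close>, with everything below it contained in \<open>x \<inter> h\<close>; so \<open>x \<inter> h\<close> can be added,
  giving a chain in \<open>E k\<close>. Enlarging a chain preserves all intersections, hence the larger chain
  dominates. Afterwards \<open>x\<close> can be dropped if it is not contained in \<open>h\<close>: a chain that meets the
  given one in \<open>x\<close> also meets it in \<open>x \<inter> h\<close>. This leads to \<open>U (Suc k)\<close>.
\<close>
lemma dismantlable_chains_below:
  assumes H: "finite_abstract_simplicial_complex H" and h: "h \<in> H"
    and G: "G = whitney_complex (phi H)"
  shows "dismantlable (whitney_complex (psi G)) {A \<in> G. \<Inter>A \<subseteq> h}"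
proof -
  have finH: "finite H"
    using H by (simp add: finite_abstract_simplicial_complex_def)
  have G_iff: "A \<in> G \<longleftrightarrow> A \<noteq> {} \<and> A \<subseteq> H \<and> chain\<^sub>\<subseteq> A" for A
    unfolding G by (rule whitney_complex_phi_iff[OF finH])
  have G_fin: "finite G" "{} \<notin> G"
    using finite_abstract_simplicial_complex_whitney_complex[OF pair_graph_phi[OF finH]]
    by (auto simp: G finite_abstract_simplicial_complex_def)
  have comparable: "x \<subseteq> y \<or> y \<subseteq> x" if "A \<in> G" "x \<in> A" "y \<in> A" for A x y
    using that by (simp add: G_iff chain_subset_def)
  have fin_mem: "finite x" if "A \<in> G" "x \<in> A" for A x
    using that H by (auto simp: G_iff finite_abstract_simplicial_complex_def)
  \<comment> \<open>Non-emptiness of \<open>x \<inter> h\<close> comes from the minimum of the chain, which lies in both sets.\<close>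
  have meet_H: "x \<inter> h \<in> H" if "A \<in> G" "\<Inter>A \<subseteq> h" "x \<in> A" for A x
  proof -
    have "\<Inter>A \<in> A"
      using that finite_subset[OF _ finH] by (intro chain_Inter_mem) (auto simp: G_iff)
    then have "\<Inter>A \<in> H"
      using that by (auto simp: G_iff)
    then have "\<Inter>A \<noteq> {}"
      by (rule complex_nonempty[OF H])
    moreover have "\<Inter>A \<subseteq> x \<inter> h"
      using that by auto
    ultimately show ?thesis
      using complex_face[OF H h, of "x \<inter> h"] by auto
  qed
  define U where "U k = {A \<in> G. \<Inter>A \<subseteq> h \<and> (\<forall>x\<in>A. card x < k \<longrightarrow> x \<subseteq> h)}" for k
  define E where "E k = {A \<in> U k. \<forall>x\<in>A. card x = k \<longrightarrow> x \<inter> h \<in> A}" for k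
  define C where "C = {A \<in> G. h \<in> A \<and> (\<forall>x\<in>A. x \<subseteq> h)}"
  have U_E: "dismantlable (whitney_complex (psi G)) (U k)"
    if "dismantlable (whitney_complex (psi G)) (E k)" for k
  proof (rule dismantlable_retract_psi[OF G_fin _ _ _ _ that,
        where f = "\<lambda>A. A \<union> (\<lambda>x. x \<inter> h) ` {x \<in> A. card x = k}"])
    fix A
    assume "A \<in> U k - E k"
    then have A: "A \<in> G" "\<Inter>A \<subseteq> h" "\<And>x. \<lbrakk>x \<in> A; card x < k\<rbrakk> \<Longrightarrow> x \<subseteq> h"
      by (auto simp: U_def)
    define B where "B = A \<union> (\<lambda>x. x \<inter> h) ` {x \<in> A. card x = k}"
    have new: "y \<subseteq> x \<inter> h \<or> x \<inter> h \<subseteq> y" if "x \<in> A" "card x = k" "y \<in> A" for x y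
    proof (cases "x \<subseteq> y")
      case False
      then have "y \<subset> x"
        using comparable[OF A(1)] that by blast
      then have "card y < k"
        using psubset_card_mono[OF fin_mem[OF A(1) that(1)]] that(2) by blast
      then show ?thesis
        using A(3)[OF that(3)] \<open>y \<subset> x\<close> by blast
    qed auto
    have "chain\<^sub>\<subseteq> B"
      unfolding chain_subset_def
    proof (intro ballI)
      fix y z
      assume yz: "y \<in> B" "z \<in> B"
      consider "y \<in> A" "z \<in> A"
        | x where "y = x \<inter> h" "x \<in> A" "card x = k" "z \<in> A"
        | x where "z = x \<inter> h" "x \<in> A" "card x = k" "y \<in> A"
        | x x' where "y = x \<inter> h" "z = x' \<inter> h" "x \<in> A" "x' \<in> A"
        using yz unfolding B_def by blast
      then show "y \<subseteq> z \<or> z \<subseteq> y"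
      proof cases
        case 1
        then show ?thesis using comparable[OF A(1)] by blast
      next
        case 2
        then show ?thesis using new by blast
      next
        case 3
        then show ?thesis using new by blast
      next
        case 4
        then show ?thesis using comparable[OF A(1), of x x'] by blast
      qed
    qed
    moreover have "B \<subseteq> H"
      using A(1) meet_H[OF A(1,2)] by (auto simp: B_def G_iff)
    moreover have "B \<noteq> {}"
      using A(1) by (auto simp: B_def G_iff)
    ultimately have "B \<in> G"
      by (simp add: G_iff)
    moreover have "\<Inter>B \<subseteq> h"
      using A(2) by (auto simp: B_def)
    moreover have "x \<subseteq> h" if "x \<in> B" "card x < k" for x
      using that A(3) by (auto simp: B_def)
    moreover have "x \<inter> h \<in> B" if "x \<in> B" "card x = k" for x
      using that by (auto simp: B_def)
    ultimately show "B \<in> E k"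
      unfolding E_def U_def by blast
  qed (auto simp: E_def U_def)
  have E_U: "dismantlable (whitney_complex (psi G)) (E k)"
    if "dismantlable (whitney_complex (psi G)) (U (Suc k))" for k
  proof (rule dismantlable_retract_psi[OF G_fin _ _ _ _ that,
        where f = "\<lambda>A. {x \<in> A. card x = k \<longrightarrow> x \<subseteq> h}"])
    show "U (Suc k) \<subseteq> E k"
      by (auto simp: E_def U_def Int_absorb2 less_Suc_eq)
    show "E k \<subseteq> G"
      by (auto simp: E_def U_def)
    fix A
    assume A: "A \<in> E k - U (Suc k)"
    then have A': "A \<in> G" "\<Inter>A \<subseteq> h" "\<And>x. \<lbrakk>x \<in> A; card x < k\<rbrakk> \<Longrightarrow> x \<subseteq> h"
      "\<And>x. \<lbrakk>x \<in> A; card x = k\<rbrakk> \<Longrightarrow> x \<inter> h \<in> A"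
      by (auto simp: U_def E_def)
    define B where "B = {x \<in> A. card x = k \<longrightarrow> x \<subseteq> h}"
    obtain x where x: "x \<in> A" "card x = k"
      using A A' by (auto simp: U_def less_Suc_eq)
    then have xh: "x \<inter> h \<in> B"
      using A'(4) by (auto simp: B_def)
    have "B \<subseteq> A"
      by (auto simp: B_def)
    then have "chain\<^sub>\<subseteq> B"
      using A'(1) chain_subset_mono[of A B] by (simp add: G_iff)
    then have "B \<in> G"
      using A'(1) xh \<open>B \<subseteq> A\<close> by (auto simp: G_iff)
    moreover have "\<Inter>B \<subseteq> h"
      using xh by blast
    moreover have "y \<subseteq> h" if "y \<in> B" "card y < Suc k" for y
      using that A'(3) by (auto simp: B_def less_Suc_eq)
    ultimately show "B \<in> U (Suc k)"
      unfolding U_def by blast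
    fix D
    assume D: "D \<in> E k" "A \<inter> D \<noteq> {}"
    then obtain z where z: "z \<in> A" "z \<in> D"
      by blast
    show "B \<inter> D \<noteq> {}"
    proof (cases "z \<in> B")
      case False
      then have "card z = k"
        using z by (auto simp: B_def)
      then have "z \<inter> h \<in> B" "z \<inter> h \<in> D"
        using z A'(4) D(1) by (auto simp: B_def E_def)
      then show ?thesis by blast
    qed (use z in blast)
  qed
  have C: "dismantlable (whitney_complex (psi G)) C"
  proof (rule dismantlable.cone)
    show hC: "{h} \<in> C"
      using h by (auto simp: C_def G_iff chain_subset_def)
    fix F
    assume F: "F \<in> insert {} (whitney_complex (psi G))" "F \<subseteq> C"
    have "insert {h} F \<subseteq> G" "\<forall>A\<in>insert {h} F. h \<in> A"
      using F(2) hC by (auto simp: C_def)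
    then show "insert {h} F \<in> whitney_complex (psi G)"
      unfolding whitney_complex_psi_iff[OF G_fin] by blast
  qed
  \<comment> \<open>From this stage on, all members of the remaining chains are contained in \<open>h\<close>.\<close>
  define N where "N = Suc (card (\<Union>H))"
  have card_N: "card x < N" if "x \<in> H" for x
    using that card_mono[OF complex_finite_vertices[OF H], of x] by (auto simp: N_def less_Suc_eq_le)
  have small: "x \<subseteq> h" if "A \<in> U N" "x \<in> A" for A x
  proof -
    have "A \<subseteq> H" "\<forall>x\<in>A. card x < N \<longrightarrow> x \<subseteq> h"
      using that(1) by (simp_all add: U_def G_iff)
    then show ?thesis
      using card_N that(2) by blast
  qed
  have "dismantlable (whitney_complex (psi G)) (U N)"
  proof (rule dismantlable_retract_psi[OF G_fin _ _ _ _ C, where f = "insert h"])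
    show "C \<subseteq> U N"
      by (auto simp: C_def U_def)
    show "U N \<subseteq> G"
      by (auto simp: U_def)
    fix A
    assume "A \<in> U N - C"
    then have A: "A \<in> U N" "A \<in> G"
      by (auto simp: U_def)
    then have "insert h A \<in> G"
      using h small[OF A(1)] by (auto simp: G_iff chain_subset_def)
    then show "insert h A \<in> C"
      using small[OF A(1)] by (auto simp: C_def)
  qed auto
  moreover have "dismantlable (whitney_complex (psi G)) (U 0)"
    if "dismantlable (whitney_complex (psi G)) (U n)" for n
    using that by (induction n) (simp_all add: U_E E_U)
  ultimately have "dismantlable (whitney_complex (psi G)) (U 0)"
    by blast
  then show ?thesis
    by (simp add: U_def)
qed

text \<open>
  The map sends a clique of pairwise intersecting chains to the union of their minima. It takes
  values in \<open>H\<close> because all the minima are faces of the maximum of any one chain of the clique.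
\<close>
lemma homotopy_equivalent_intersection_graph:
  assumes H: "finite_abstract_simplicial_complex H"
    and G: "G = whitney_complex (phi H)"
  shows "graph_realization (psi G) homotopy_equivalent_space geometric_realization G"
proof -
  have finH: "finite H"
    using H by (simp add: finite_abstract_simplicial_complex_def)
  have G_iff: "A \<in> G \<longleftrightarrow> A \<noteq> {} \<and> A \<subseteq> H \<and> chain\<^sub>\<subseteq> A" for A
    unfolding G by (rule whitney_complex_phi_iff[OF finH])
  have G_fin: "finite G" "{} \<notin> G"
    using finite_abstract_simplicial_complex_whitney_complex[OF pair_graph_phi[OF finH]]
    by (auto simp: G finite_abstract_simplicial_complex_def)
  have fin: "finite A" if "A \<in> G" for A
    using that finite_subset[OF _ finH] by (auto simp: G_iff)
  have "geometric_realization (whitney_complex (psi G)) homotopy_equivalent_space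
        geometric_realization (whitney_complex (phi H))"
  proof (rule homotopy_equivalent_order_complex[where j = Inter])
    show "finite_abstract_simplicial_complex (whitney_complex (psi G))"
      by (intro finite_abstract_simplicial_complex_whitney_complex pair_graph_psi G_fin)
    show "finite H" by (rule finH)
  next
    fix F
    assume "F \<in> whitney_complex (psi G)"
    then have F: "F \<noteq> {}" "F \<subseteq> G" "\<And>A B. \<lbrakk>A \<in> F; B \<in> F\<rbrakk> \<Longrightarrow> A \<inter> B \<noteq> {}"
      using whitney_complex_psi_iff[OF G_fin] by auto
    then obtain B where B: "B \<in> F"
      by blast
    then have "B \<in> G"
      using F(2) by blast
    then have B_chain: "B \<noteq> {}" "B \<subseteq> H" "chain\<^sub>\<subseteq> B"
      by (simp_all add: G_iff)
    have mem: "\<Union>B \<in> B" "\<Inter>B \<in> B"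
      using chain_Union_mem[OF fin[OF \<open>B \<in> G\<close>]] chain_Inter_mem[OF fin[OF \<open>B \<in> G\<close>]] B_chain
      by simp_all
    have below: "\<Inter>A \<subseteq> \<Union>B" if A: "A \<in> F" for A
    proof -
      obtain x where "x \<in> A" "x \<in> B"
        using F(3)[OF A B] by auto
      then show ?thesis
        by (meson Inter_lower Sup_upper order_trans)
    qed
    show "(\<Union>A\<in>F. \<Inter>A) \<in> H"
    proof (rule complex_face[OF H])
      show "\<Union>B \<in> H"
        using mem(1) B_chain(2) by (rule rev_subsetD)
      show "(\<Union>A\<in>F. \<Inter>A) \<subseteq> \<Union>B"
        using below by (rule UN_least)
      have "\<Inter>B \<noteq> {}"
        using complex_nonempty[OF H rev_subsetD[OF mem(2) B_chain(2)]] .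
      then show "(\<Union>A\<in>F. \<Inter>A) \<noteq> {}"
        using UN_upper[OF B, of Inter] by (metis subset_empty)
    qed
  next
    fix h
    assume h: "h \<in> H"
    have "{A} \<in> whitney_complex (psi G)" if "A \<in> G" for A
      using that G_fin(2) by (auto simp: whitney_complex_psi_iff[OF G_fin])
    then have "\<Union>(whitney_complex (psi G)) = G"
      using whitney_complex_psi_iff[OF G_fin] by blast
    then show "dismantlable (whitney_complex (psi G)) {A \<in> \<Union>(whitney_complex (psi G)). \<Inter>A \<subseteq> h}"
      using dismantlable_chains_below[OF H h G] by simp
  qed
  then show ?thesis
    by (simp add: graph_realization_def flip: G)
qed

theorem corollary4:
  fixes G :: "'a set set set"
  assumes "finite_abstract_simplicial_complex G"
    and "barycentric G"
  shows "geometric_realization G homotopy_equivalent_space graph_realization (phi G) \<and>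
         geometric_realization G homotopy_equivalent_space graph_realization (psi G) \<and>
         graph_realization (phi G) homotopy_equivalent_space graph_realization (psi G)"
proof -
  obtain H :: "'a set set"
    where H: "finite_abstract_simplicial_complex H" "G = whitney_complex (phi H)"
    using assms(2) unfolding barycentric_def by blast
  have "geometric_realization G homotopy_equivalent_space graph_realization (phi G)"
    by (rule homotopy_equivalent_barycentric_subdivision[OF assms(1)])
  moreover have "geometric_realization G homotopy_equivalent_space graph_realization (psi G)"
    by (rule iffD1[OF homotopy_equivalent_space_sym homotopy_equivalent_intersection_graph[OF H]])
  ultimately show ?thesis
    by (meson homotopy_equivalent_space_sym homotopy_eqv_trans)
qed

end
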